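(* Let $n\ge 1$, let $u,v\in\mathbb{C}^n$ satisfy $\sum_{p}|u_p|^2=\sum_p|v_p|^2=1$, let $\lambda\in\mathbb{C}$, and let $\hat L=\lambda\,\hat a_u^\dagger\hat a_v$ be the associated bilinear rank-one operator on $(\mathbb{C}^2)^{\otimes n}$, whose action is considered on the one-excitation subspace $\mathcal H_1$ (where $\hat a_u^\dagger\hat a_v$ acts as the dyad $|u\rangle\langle v|$). Then for every $\epsilon>0$ and every normalization $\alpha>0$ with $\alpha\ge|\lambda|$ there exists a unitary $W$ on $\mathbb{C}^2\otimes(\mathbb{C}^2)^{\otimes n}$ (one ancilla qubit and the $n$-qubit system) such that $$\Bigl\|\Pi_1\Bigl[(\langle 0|\otimes I)\,W\,(|0\rangle\otimes I)-\hat L/\alpha\Bigr]\Pi_1\Bigr\|<\epsilon,$$ where $\Pi_1$ is the orthogonal projector onto $\mathcal H_1$ and $\|\cdot\|$ is the operator norm.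
   Context: The $n$-qubit space $(\mathbb{C}^2)^{\otimes n}$ is identified with the fermionic Fock space on $n$ spin-orbitals (one qubit per spin-orbital, e.g. via the Jordan--Wigner mapping, with computational basis states being occupation-number states). $a_p^\dagger,a_p$ ($1\le p\le n$) are the standard fermionic creation/annihilation operators satisfying the canonical anticommutation relations, and $|0^n\rangle$ is the vacuum. For $u,v\in\mathbb{C}^n$, $$\hat a_u^\dagger=\sum_{p=1}^n u_p a_p^\dagger,\qquad \hat a_v=\sum_{q=1}^n v_q^* a_q,\qquad |u\rangle=\hat a_u^\dagger|0^n\rangle,\quad |v\rangle=\hat a_v^\dagger|0^n\rangle,$$ where $\hat a_v^\dagger=(\hat a_v)^\dagger$. $\mathcal H_1\subset(\mathbb{C}^2)^{\otimes n}$ is the one-particle sector, i.e. the span of the states $a_p^\dagger|0^n\rangle$, $1\le p\le n$. The operator $(\langle 0|\otimes I)W(|0\rangle\otimes I)$ is the block of $W$ on the system obtained by initializing and projecting the ancilla in $|0\rangle$. *)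

theory Defs
  imports "HOL-Analysis.Analysis"
begin

section \<open>Complex matrices\<close>

definition dagger :: "complex ^ 'b ^ 'a \<Rightarrow> complex ^ 'a ^ 'b" where
  "dagger A = (\<chi> i j. cnj (A $ j $ i))"

definition unitary_mat :: "complex ^ 'a ^ 'a \<Rightarrow> bool" where
  "unitary_mat U \<longleftrightarrow> dagger U ** U = mat 1 \<and> U ** dagger U = mat 1"

definition cscale :: "complex \<Rightarrow> complex ^ 'b ^ 'a \<Rightarrow> complex ^ 'b ^ 'a" where
  "cscale c A = map_matrix ((*) c) A"

definition op_norm :: "complex ^ 'b ^ 'a \<Rightarrow> real" where
  "op_norm A = onorm ((*v) A)"

definition orthogonal_projector :: "(complex ^ 'a) set \<Rightarrow> complex ^ 'a ^ 'a \<Rightarrow> bool" where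
  "orthogonal_projector S P \<longleftrightarrow> P ** P = P \<and> dagger P = P \<and> range ((*v) P) = S"

section \<open>Qubits and the Jordan--Wigner representation\<close>

text \<open>
  A qubit is \<^typ>\<open>complex ^ 2\<close>, with basis labelled by the elements \<open>0\<close> and \<open>1\<close> of the index
  type \<^typ>\<open>2\<close>. The \<open>n\<close>-fold tensor power of \<^typ>\<open>complex ^ 2\<close>, one factor for each element of
  the \<open>n\<close>-element type \<open>'n\<close>, is \<open>complex ^ ('n \<Rightarrow> 2)\<close>: its standard basis is labelled by bit strings,
  read as occupation numbers. The linear order on \<open>'n\<close> enumerates the spin-orbitals.
\<close>

definition qubit_tensor :: "('n::finite \<Rightarrow> complex ^ 2 ^ 2) \<Rightarrow> complex ^ ('n \<Rightarrow> 2) ^ ('n \<Rightarrow> 2)" where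
  "qubit_tensor M = (\<chi> x y. \<Prod>p\<in>UNIV. M p $ x p $ y p)"

definition pauli_Z :: "complex ^ 2 ^ 2" where
  "pauli_Z = (\<chi> i j. if i = j then (if i = 0 then 1 else -1) else 0)"

text \<open>The matrix of \<open>|0\<rangle>\<langle>1|\<close>.\<close>

definition lowering :: "complex ^ 2 ^ 2" where
  "lowering = (\<chi> i j. if i = 0 \<and> j = 1 then 1 else 0)"

definition annihilation :: "'n::{finite,linorder} \<Rightarrow> complex ^ ('n \<Rightarrow> 2) ^ ('n \<Rightarrow> 2)" where
  "annihilation p = qubit_tensor (\<lambda>q. if q < p then pauli_Z else if q = p then lowering else mat 1)"

definition creation :: "'n::{finite,linorder} \<Rightarrow> complex ^ ('n \<Rightarrow> 2) ^ ('n \<Rightarrow> 2)" where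
  "creation p = dagger (annihilation p)"

definition vacuum :: "complex ^ ('n::finite \<Rightarrow> 2)" where
  "vacuum = axis (\<lambda>_. 0) 1"

definition creation_comb :: "complex ^ 'n::{finite,linorder} \<Rightarrow> complex ^ ('n \<Rightarrow> 2) ^ ('n \<Rightarrow> 2)" where
  "creation_comb u = (\<Sum>p\<in>UNIV. cscale (u $ p) (creation p))"

definition annihilation_comb :: "complex ^ 'n::{finite,linorder} \<Rightarrow> complex ^ ('n \<Rightarrow> 2) ^ ('n \<Rightarrow> 2)" where
  "annihilation_comb v = (\<Sum>q\<in>UNIV. cscale (cnj (v $ q)) (annihilation q))"

definition bilinear_rank_one ::
    "complex \<Rightarrow> complex ^ 'n::{finite,linorder} \<Rightarrow> complex ^ 'n::{finite,linorder} \<Rightarrow> complex ^ ('n \<Rightarrow> 2) ^ ('n \<Rightarrow> 2)" where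
  "bilinear_rank_one l u v = cscale l (creation_comb u ** annihilation_comb v)"

definition one_particle_sector :: "(complex ^ ('n::{finite,linorder} \<Rightarrow> 2)) set" where
  "one_particle_sector = vec.span (range (\<lambda>p. creation p *v vacuum))"

definition one_particle_projector :: "complex ^ ('n::{finite,linorder} \<Rightarrow> 2) ^ ('n \<Rightarrow> 2)" where
  "one_particle_projector = (THE P. orthogonal_projector one_particle_sector P)"

section \<open>The ancilla block\<close>

text \<open>\<open>C\<^sup>2 \<otimes> C\<^sup>a\<close> is \<open>complex ^ (2 \<times> 'a)\<close>; \<open>ket_tensor k A\<close> is the operator \<open>x \<mapsto> k \<otimes> A x\<close>.\<close>

definition ket_tensor :: "complex ^ 2 \<Rightarrow> complex ^ 'b ^ 'a \<Rightarrow> complex ^ 'b ^ (2 \<times> 'a)" where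
  "ket_tensor k A = (\<chi> i j. k $ fst i * A $ snd i $ j)"

definition ancilla_block :: "complex ^ (2 \<times> 'a) ^ (2 \<times> 'a) \<Rightarrow> complex ^ 'a ^ 'a" where
  "ancilla_block W = dagger (ket_tensor (axis 0 1) (mat 1)) ** W ** ket_tensor (axis 0 1) (mat 1)"

section \<open>Consistency of the definitions\<close>

lemma dagger_nth [simp]: "dagger A $ i $ j = cnj (A $ j $ i)"
  by (simp add: dagger_def)

lemma dagger_dagger [simp]: "dagger (dagger A) = A"
  by (simp add: vec_eq_iff)

lemma dagger_mult: "dagger (A ** B) = dagger B ** dagger A"
  by (simp add: vec_eq_iff matrix_matrix_mult_def mult.commute)

lemma dagger_sum: "dagger (\<Sum>i\<in>I. A i) = (\<Sum>i\<in>I. dagger (A i))"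
  by (simp add: vec_eq_iff)

lemma dagger_cscale: "dagger (cscale c A) = cscale (cnj c) (dagger A)"
  by (simp add: vec_eq_iff cscale_def)

lemma dagger_annihilation_comb: "dagger (annihilation_comb v) = creation_comb v"
  by (simp add: annihilation_comb_def creation_comb_def dagger_sum dagger_cscale creation_def)

lemma orthogonal_projector_unique:
  assumes P: "orthogonal_projector S P" and Q: "orthogonal_projector S Q"
  shows "P = Q"
proof -
  have *: "A ** B = B" if "orthogonal_projector S A" "orthogonal_projector S B" for A B
  proof -
    have "A *v (B *v x) = B *v x" for x
    proof -
      have "B *v x \<in> range ((*v) A)"
        using that by (auto simp: orthogonal_projector_def)
      then obtain y where "B *v x = A *v y" by auto
      then show ?thesis
        using that(1) by (simp add: orthogonal_projector_def matrix_vector_mul_assoc)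
    qed
    then show ?thesis
      by (simp add: matrix_eq matrix_vector_mul_assoc)
  qed
  have "P = dagger (Q ** P)"
    using *[OF Q P] P by (simp add: orthogonal_projector_def)
  also have "\<dots> = P ** Q"
    using P Q by (simp add: dagger_mult orthogonal_projector_def)
  also have "\<dots> = Q" by (rule *[OF P Q])
  finally show ?thesis .
qed

lemma two_cases: "(i::2) = 0 \<or> i = 1"
  using exhaust_2[of i] by auto

lemma UNIV_2': "(UNIV :: 2 set) = {0, 1}"
  using two_cases by auto

lemma all_2: "(\<forall>i::2. P i) \<longleftrightarrow> P 0 \<and> P 1"
  using two_cases by metis

lemma qubit_tensor_mult: "qubit_tensor M ** qubit_tensor N = qubit_tensor (\<lambda>p. M p ** N p)"
proof -
  have "(\<Sum>z\<in>UNIV. (\<Prod>p\<in>UNIV. M p $ x p $ z p) * (\<Prod>p\<in>UNIV. N p $ z p $ y p))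
      = (\<Prod>p\<in>UNIV. \<Sum>k\<in>UNIV. M p $ x p $ k * N p $ k $ y p)" for x y :: "'a \<Rightarrow> 2"
    using prod_sum_PiE[of "UNIV :: 'a set" "\<lambda>_. UNIV :: 2 set" "\<lambda>p k. M p $ x p $ k * N p $ k $ y p"]
    by (simp add: prod.distrib PiE_UNIV_domain)
  then show ?thesis
    by (simp add: vec_eq_iff matrix_matrix_mult_def qubit_tensor_def)
qed

lemma qubit_tensor_add:
  assumes "\<And>r. r \<noteq> s \<Longrightarrow> M r = K r \<and> N r = K r" "M s + N s = K s"
  shows "qubit_tensor M + qubit_tensor N = qubit_tensor K"
proof -
  have "(\<Prod>p\<in>UNIV. M p $ x p $ y p) + (\<Prod>p\<in>UNIV. N p $ x p $ y p) = (\<Prod>p\<in>UNIV. K p $ x p $ y p)"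
    for x y
    using assms(1)
    by (simp add: prod.remove[of UNIV s] distrib_right flip: assms(2))
  then show ?thesis
    by (simp add: vec_eq_iff qubit_tensor_def)
qed

lemma qubit_tensor_one: "qubit_tensor (\<lambda>_. mat 1) = mat 1"
  by (auto simp: vec_eq_iff qubit_tensor_def mat_def fun_eq_iff)

lemma qubit_tensor_zero: "M s = 0 \<Longrightarrow> qubit_tensor M = 0"
  by (auto simp: vec_eq_iff qubit_tensor_def intro!: prod_zero)

lemma dagger_qubit_tensor: "dagger (qubit_tensor M) = qubit_tensor (\<lambda>p. dagger (M p))"
  by (simp add: vec_eq_iff qubit_tensor_def)

lemma single_qubit_relations:
  "pauli_Z ** pauli_Z = mat 1" "dagger pauli_Z = pauli_Z" "dagger (mat 1 :: complex ^ 2 ^ 2) = mat 1"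
  "lowering ** lowering = 0"
  "lowering ** dagger lowering + dagger lowering ** lowering = mat 1"
  "lowering ** pauli_Z + pauli_Z ** lowering = 0"
  "dagger lowering ** pauli_Z + pauli_Z ** dagger lowering = 0"
  "pauli_Z ** lowering + lowering ** pauli_Z = 0"
  "pauli_Z ** dagger lowering + dagger lowering ** pauli_Z = 0"
  by (simp_all add: vec_eq_iff matrix_matrix_mult_def mat_def pauli_Z_def lowering_def UNIV_2' all_2)

lemma annihilation_anticommute:
  "annihilation p ** annihilation q + annihilation q ** annihilation p = 0"
proof -
  let ?F = "\<lambda>p q. if q < p then pauli_Z else if q = p then lowering else mat 1"
  let ?K = "\<lambda>r. if r = min p q then 0 else ?F p r ** ?F q r"
  have "qubit_tensor (\<lambda>r. ?F p r ** ?F q r) + qubit_tensor (\<lambda>r. ?F q r ** ?F p r) = qubit_tensor ?K"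
    by (rule qubit_tensor_add[of "min p q"]) (auto simp: single_qubit_relations min_def split: if_splits)
  also have "\<dots> = 0" by (rule qubit_tensor_zero[of _ "min p q"]) simp
  finally show ?thesis by (simp add: annihilation_def qubit_tensor_mult)
qed

lemma annihilation_creation_anticommute:
  "annihilation p ** creation q + creation q ** annihilation p = (if p = q then mat 1 else 0)"
proof -
  let ?F = "\<lambda>p q. if q < p then pauli_Z else if q = p then lowering else mat 1"
  let ?K = "\<lambda>r. if r = min p q then (if p = q then mat 1 else 0) else ?F p r ** dagger (?F q r)"
  have "qubit_tensor (\<lambda>r. ?F p r ** dagger (?F q r)) + qubit_tensor (\<lambda>r. dagger (?F q r) ** ?F p r)
      = qubit_tensor ?K"
    by (rule qubit_tensor_add[of "min p q"]) (auto simp: single_qubit_relations min_def split: if_splits)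
  also have "\<dots> = (if p = q then mat 1 else 0)"
  proof (cases "p = q")
    case True
    then have "?K = (\<lambda>_. mat 1)" by (auto simp: single_qubit_relations)
    then show ?thesis using True by (simp add: qubit_tensor_one)
  next
    case False
    then show ?thesis by (simp add: qubit_tensor_zero[of _ "min p q"])
  qed
  finally show ?thesis
    by (simp add: annihilation_def creation_def dagger_qubit_tensor qubit_tensor_mult)
qed

lemma matrix_mult_axis: "A *v axis i 1 = (\<chi> j. A $ j $ i)" for A :: "complex ^ 'b ^ 'a"
  by (simp add: matrix_vector_mult_def axis_def if_distrib cong: if_cong)

lemma annihilation_vacuum: "annihilation p *v vacuum = 0"
  by (auto simp: vacuum_def matrix_mult_axis vec_eq_iff annihilation_def qubit_tensor_def
      lowering_def intro!: bexI[of _ p])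

lemma creation_vacuum: "creation p *v vacuum = axis (\<lambda>q. if q = p then 1 else 0) 1"
proof -
  have "(\<Prod>q\<in>UNIV. (if q < p then pauli_Z else if q = p then lowering else mat 1) $ 0 $ x q)
      = (if x = (\<lambda>q. if q = p then 1 else 0) then 1 else 0)" for x :: "'a \<Rightarrow> 2"
  proof (cases "x = (\<lambda>q. if q = p then 1 else 0)")
    case True
    then show ?thesis
      by (intro trans[OF prod.neutral]) (auto simp: pauli_Z_def lowering_def mat_def)
  next
    case False
    then obtain q where "x q \<noteq> (if q = p then 1 else 0)" by auto
    then have "(if q < p then pauli_Z else if q = p then lowering else mat 1) $ 0 $ x q = 0"
      by (auto simp: pauli_Z_def lowering_def mat_def split: if_splits)
    then have "\<exists>q\<in>UNIV. (if q < p then pauli_Z else if q = p then lowering else mat 1) $ 0 $ x q = 0"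
      by blast
    then show ?thesis using False by (simp add: prod_zero)
  qed
  then show ?thesis
    unfolding vacuum_def matrix_mult_axis
    by (simp add: vec_eq_iff creation_def annihilation_def qubit_tensor_def axis_def)
qed

lemma ex_one_particle_projector:
  "\<exists>P. orthogonal_projector (one_particle_sector :: (complex ^ ('n::{finite,linorder} \<Rightarrow> 2)) set) P"
proof -
  define e :: "'n \<Rightarrow> 'n \<Rightarrow> 2" where "e = (\<lambda>p q. if q = p then 1 else 0)"
  define P :: "complex ^ ('n \<Rightarrow> 2) ^ ('n \<Rightarrow> 2)"
    where "P = (\<chi> x y. if x = y \<and> x \<in> range e then 1 else 0)"
  have e_inj: "e p = e q \<longleftrightarrow> p = q" for p q
    by (auto simp: e_def fun_eq_iff split: if_splits)
  have P_nth: "(P *v z) $ x = (if x \<in> range e then z $ x else 0)" for z x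
    by (auto simp: P_def matrix_vector_mult_def if_distrib if_distribR cong: if_cong)
  have P_sum: "P *v z = (\<Sum>p\<in>UNIV. z $ e p *s axis (e p) 1)" for z
    by (auto simp: vec_eq_iff P_nth axis_def e_inj if_distrib sum.delta cong: if_cong
        intro!: sum.neutral)
  have sec: "(one_particle_sector :: (complex ^ ('n \<Rightarrow> 2)) set) = vec.span (range (\<lambda>p. axis (e p) 1))"
    by (simp add: one_particle_sector_def creation_vacuum e_def)
  have "P ** P = P"
    by (simp add: matrix_eq vec_eq_iff P_nth flip: matrix_vector_mul_assoc)
  moreover have "dagger P = P"
    by (auto simp: vec_eq_iff P_def)
  moreover have "range ((*v) P) = one_particle_sector"
  proof
    show "range ((*v) P) \<subseteq> one_particle_sector"
      unfolding sec P_sum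
      by (rule image_subsetI, rule vec.span_sum, rule vec.span_scale, rule vec.span_base, rule rangeI)
    have fixed: "P *v z = z" if "z \<in> vec.span (range (\<lambda>p. axis (e p) 1))" for z
      using that
    proof (induction rule: vec.span_induct_alt)
      case base
      then show ?case by simp
    next
      case (step c x y)
      then obtain p where x: "x = axis (e p) 1" by auto
      have "P *v x = x"
        by (auto simp: x vec_eq_iff P_nth axis_def)
      then show ?case using step.IH
        by (simp add: matrix_vector_right_distrib vector_scalar_commute)
    qed
    show "one_particle_sector \<subseteq> range ((*v) P)"
    proof
      fix z :: "complex ^ ('n \<Rightarrow> 2)" assume "z \<in> one_particle_sector"
      then have "z = P *v z" unfolding sec by (rule fixed[symmetric])
      then show "z \<in> range ((*v) P)" by (rule range_eqI)
    qed
  qed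
  ultimately show ?thesis unfolding orthogonal_projector_def by blast
qed

lemma one_particle_projector: "orthogonal_projector one_particle_sector one_particle_projector"
  unfolding one_particle_projector_def
  by (rule theI') (metis ex_one_particle_projector orthogonal_projector_unique)

lemma cscale_mult_vec: "cscale c A *v x = c *s (A *v x)"
  by (simp add: vec_eq_iff cscale_def matrix_vector_mult_def sum_distrib_left mult.assoc)

lemma sum_mult_vec: "(\<Sum>i\<in>I. A i) *v x = (\<Sum>i\<in>I. A i *v x)" for A :: "'i \<Rightarrow> complex ^ 'b ^ 'a"
  by (induction I rule: infinite_finite_induct) (simp_all add: matrix_vector_mult_add_rdistrib)

lemma annihilation_creation_vacuum:
  "annihilation q *v (creation p *v vacuum) = (if q = p then vacuum else 0)"
proof -
  have "annihilation q *v (creation p *v vacuum) + creation p *v (annihilation q *v vacuum)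
      = (if q = p then mat 1 else 0) *v vacuum"
    by (simp only: matrix_vector_mul_assoc annihilation_creation_anticommute
        flip: matrix_vector_mult_add_rdistrib)
  then show ?thesis by (simp add: annihilation_vacuum split: if_splits)
qed

text \<open>On the one-particle sector \<open>creation_comb u ** annihilation_comb v\<close> is the dyad \<open>|u\<rangle>\<langle>v|\<close>.\<close>

lemma bilinear_dyad:
  assumes "x \<in> one_particle_sector"
  shows "(creation_comb u ** annihilation_comb v) *v x
    = (\<Sum>i\<in>UNIV. cnj ((creation_comb v *v vacuum) $ i) * x $ i) *s (creation_comb u *v vacuum)"
proof -
  let ?ip = "\<lambda>x. \<Sum>i\<in>UNIV. cnj ((creation_comb v *v vacuum) $ i) * x $ i"
  have "annihilation_comb v *v x = ?ip x *s vacuum"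
    using assms unfolding one_particle_sector_def
  proof (induction rule: vec.span_induct_alt)
    case base
    then show ?case by simp
  next
    case (step c x y)
    then obtain p where x: "x = creation p *v vacuum" by auto
    let ?e = "\<lambda>q. if q = p then 1 else 0 :: 2"
    have e: "(\<lambda>q. if q = r then 1 else 0 :: 2) = ?e \<longleftrightarrow> r = p" for r
      by (auto simp: fun_eq_iff split: if_splits)
    have e': "?e = (\<lambda>q. if q = r then 1 else 0 :: 2) \<longleftrightarrow> r = p" for r
      using e by metis
    have "(creation_comb v *v vacuum) $ ?e = (\<Sum>q\<in>UNIV. if q = p then v $ q else 0)"
      unfolding creation_comb_def sum_mult_vec cscale_mult_vec creation_vacuum sum_component
      by (rule sum.cong) (simp_all add: axis_def e')
    then have ket: "(creation_comb v *v vacuum) $ ?e = v $ p" by simp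
    have "?ip x = (\<Sum>i\<in>UNIV. if i = ?e then cnj ((creation_comb v *v vacuum) $ i) else 0)"
      unfolding x creation_vacuum by (rule sum.cong) (simp_all add: axis_def)
    then have "?ip x = cnj (v $ p)" by (simp add: ket)
    moreover have "annihilation_comb v *v x
        = (\<Sum>q\<in>UNIV. if q = p then cnj (v $ q) *s vacuum else 0)"
      unfolding x annihilation_comb_def sum_mult_vec cscale_mult_vec annihilation_creation_vacuum
      by (rule sum.cong) simp_all
    then have "annihilation_comb v *v x = cnj (v $ p) *s vacuum" by simp
    moreover have "?ip (c *s x + y) = c * ?ip x + ?ip y"
      by (simp add: distrib_left sum.distrib sum_distrib_left mult.left_commute)
    ultimately show ?case using step.IH
      by (simp only: matrix_vector_right_distrib vec.scale_left_distrib vector_scalar_commute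
          vec.scale_scale)
  qed
  then show ?thesis
    by (simp only: vector_scalar_commute flip: matrix_vector_mul_assoc)
qed

end

theory Submission
  imports Defs
begin

text \<open>
  The dyad \<open>A = (l / \<alpha>) |u\<rangle>\<langle>v|\<close> is a contraction, so its Halmos dilation, with rows
  \<open>(A, \<surd>(1 - A A\<^sup>\<dagger>))\<close> and \<open>(\<surd>(1 - A\<^sup>\<dagger> A), -A\<^sup>\<dagger>)\<close>, is unitary and has \<open>A\<close> itself as its ancilla
  block: the error vanishes on the one-particle sector. Because \<open>|u\<rangle>\<close> and \<open>|v\<rangle>\<close> are unit vectors,
  the square roots are the rank-one perturbations \<open>1 + (s - 1) |u\<rangle>\<langle>u|\<close> and
  \<open>1 + (s - 1) |v\<rangle>\<langle>v|\<close> of the identity, where \<open>s = \<surd>(1 - |l / \<alpha>|\<^sup>2)\<close>.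
\<close>

text \<open>The operator \<open>c|a><b|\<close>. Keeping the scalar as an argument lets adjoints,
  sums over the same pair of vectors and products through a unit vector stay dyads, so that
  unitarity reduces to arithmetic on coefficients.\<close>

definition dyad :: "complex \<Rightarrow> complex ^ 'a \<Rightarrow> complex ^ 'b \<Rightarrow> complex ^ 'b ^ 'a" where
  "dyad c a b = (\<chi> i j. c * a $ i * cnj (b $ j))"

lemma dagger_dyad: "dagger (dyad c a b) = dyad (cnj c) b a"
  by (simp add: vec_eq_iff dyad_def mult_ac)

lemma dagger_add: "dagger (A + B) = dagger A + dagger B"
  by (simp add: vec_eq_iff)

lemma dagger_mat_1: "dagger (mat 1) = mat 1"
  by (auto simp: vec_eq_iff mat_def)

lemma dyad_add: "dyad c a b + dyad d a b = dyad (c + d) a b"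
  by (simp add: vec_eq_iff dyad_def algebra_simps)

lemma dyad_zero: "dyad 0 a b = 0"
  by (simp add: vec_eq_iff dyad_def)

lemma matrix_add_mult_distrib: "(A + B) ** C = A ** C + B ** C"
  for A B :: "complex ^ 'b ^ 'a"
  by (simp add: vec_eq_iff matrix_matrix_mult_def algebra_simps sum.distrib)

lemma dyad_mult:
  assumes "(\<Sum>i\<in>UNIV. cnj (b $ i) * b $ i) = 1"
  shows "dyad c a b ** dyad d b e = dyad (c * d) a e"
proof -
  have "(\<Sum>k\<in>UNIV. c * a $ i * cnj (b $ k) * (d * b $ k * cnj (e $ j)))
      = c * d * a $ i * cnj (e $ j) * (\<Sum>k\<in>UNIV. cnj (b $ k) * b $ k)" for i j
    unfolding sum_distrib_left by (rule sum.cong) (simp_all add: mult_ac)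
  then show ?thesis
    by (simp add: vec_eq_iff matrix_matrix_mult_def dyad_def assms)
qed

lemma dyad_mult_vec: "dyad c a b *v x = (c * (\<Sum>i\<in>UNIV. cnj (b $ i) * x $ i)) *s a"
  by (simp add: vec_eq_iff matrix_vector_mult_def dyad_def sum_distrib_left sum_distrib_right mult_ac)

definition ancilla_matrix ::
    "complex ^ 'a ^ 'a \<Rightarrow> complex ^ 'a ^ 'a \<Rightarrow> complex ^ 'a ^ 'a \<Rightarrow> complex ^ 'a ^ 'a
      \<Rightarrow> complex ^ (2 \<times> 'a) ^ (2 \<times> 'a)" where
  "ancilla_matrix A B C D = (\<chi> i j.
     (if fst i = 0 then if fst j = 0 then A else B else if fst j = 0 then C else D) $ snd i $ snd j)"

lemma sum_ancilla: "(\<Sum>k\<in>UNIV. f k) = (\<Sum>j\<in>UNIV. f (0, j)) + (\<Sum>j\<in>UNIV. f (1, j))"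
  for f :: "2 \<times> 'a::finite \<Rightarrow> complex"
proof -
  have "(\<Sum>k\<in>UNIV. f k) = (\<Sum>i\<in>UNIV. \<Sum>j\<in>UNIV. f (i, j))"
    by (simp only: UNIV_Times_UNIV sum.cartesian_product case_prod_eta)
  then show ?thesis
    by (simp add: UNIV_2')
qed

lemma ancilla_matrix_mult:
  "ancilla_matrix A B C D ** ancilla_matrix A' B' C' D'
    = ancilla_matrix (A ** A' + B ** C') (A ** B' + B ** D') (C ** A' + D ** C') (C ** B' + D ** D')"
  by (auto simp: vec_eq_iff matrix_matrix_mult_def ancilla_matrix_def sum_ancilla)

lemma dagger_ancilla_matrix:
  "dagger (ancilla_matrix A B C D) = ancilla_matrix (dagger A) (dagger C) (dagger B) (dagger D)"
  by (simp add: vec_eq_iff ancilla_matrix_def)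

lemma ancilla_matrix_one: "ancilla_matrix (mat 1) 0 0 (mat 1) = mat 1"
  by (simp add: vec_eq_iff ancilla_matrix_def mat_def split_paired_All all_2)

text \<open>Tensoring with \<open>|0>\<close> sends basis vector \<open>j\<close> to
  \<open>(0, j)\<close>, so the outer factors only select rows and columns with ancilla value
  0.\<close>

lemma ancilla_block_nth: "ancilla_block W $ i $ j = W $ (0, i) $ (0, j)"
proof -
  have ket: "ket_tensor (axis 0 1) (mat 1) $ (0, m) $ k = (if m = k then 1 else 0)"
    "ket_tensor (axis 0 1) (mat 1) $ (1, m) $ k = 0" for m k :: 'a
    by (simp_all add: ket_tensor_def mat_def axis_def)
  have "(\<Sum>m\<in>UNIV. (if m = k then 1 else 0) * f m) = f k"
    "(\<Sum>m\<in>UNIV. f m * (if m = k then 1 else 0)) = f k" for f :: "'a \<Rightarrow> complex" and k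
    by (simp_all add: mult_if_delta mult.commute[of "f _"])
  moreover have cnj_if: "cnj (if P then 1 else 0) = (if P then 1 else 0)" for P
    by simp
  ultimately show ?thesis
    by (simp add: ancilla_block_def matrix_matrix_mult_def sum_ancilla ket cnj_if)
qed

lemma ancilla_block_ancilla_matrix: "ancilla_block (ancilla_matrix A B C D) = A"
  by (simp add: vec_eq_iff ancilla_block_nth ancilla_matrix_def)

text \<open>Put \<open>t = s - 1\<close>. In \<open>dagger W ** W\<close> each off-diagonal block is
  a sum of two dyads with opposite coefficients, and each diagonal block is the identity plus a dyad
  with coefficient \<open>|c|^2 + 2t + t^2 = |c|^2 + s^2 - 1 = 0\<close>.\<close>

lemma unitary_ancilla_matrix_dyad:
  fixes a b :: "complex ^ 'a::finite"
  assumes a: "(\<Sum>i\<in>UNIV. cnj (a $ i) * a $ i) = 1"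
    and b: "(\<Sum>i\<in>UNIV. cnj (b $ i) * b $ i) = 1"
    and s: "(cmod c)\<^sup>2 + s\<^sup>2 = 1"
  shows "unitary_mat (ancilla_matrix (dyad c a b) (mat 1 + dyad (complex_of_real s - 1) a a)
    (mat 1 + dyad (complex_of_real s - 1) b b) (- dagger (dyad c a b)))"
    (is "unitary_mat ?W")
proof -
  define t where "t = complex_of_real s - 1"
  have "complex_of_real ((cmod c)\<^sup>2 + s\<^sup>2) = 1"
    by (simp only: s of_real_1)
  then have "c * cnj c + (complex_of_real s)\<^sup>2 = 1"
    by (simp only: of_real_add complex_norm_square) (simp only: of_real_power)
  \<comment> \<open>The two orders of summands are those that arise in the upper and in the lower
    diagonal block.\<close>
  then have t: "c * cnj c + (t * 2 + t * t) = 0" "t * 2 + t * t + c * cnj c = 0"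
    by (simp_all add: t_def algebra_simps power2_eq_square)
  have real: "cnj t = t"
    by (simp add: t_def)
  have neg: "- dyad d x y = dyad (- d) x y" for d and x y :: "complex ^ 'a"
    by (simp add: vec_eq_iff dyad_def)
  have W: "?W = ancilla_matrix (dyad c a b) (mat 1 + dyad t a a) (mat 1 + dyad t b b) (dyad (- cnj c) b a)"
    by (simp add: t_def dagger_dyad neg)
  have W': "dagger ?W
      = ancilla_matrix (dyad (cnj c) b a) (mat 1 + dyad t b b) (mat 1 + dyad t a a) (dyad (- c) a b)"
    unfolding W by (simp add: dagger_ancilla_matrix dagger_add dagger_dyad dagger_mat_1 real)
  have sum1: "dyad d x y + (mat 1 + dyad e x y) = mat 1 + dyad (d + e) x y"
    "mat 1 + dyad e x y + dyad d x y = mat 1 + dyad (e + d) x y" for d e and x y :: "complex ^ 'a"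
    by (simp_all add: add_ac flip: dyad_add)
  have sq: "(mat 1 + dyad t x x) ** (mat 1 + dyad t x x) = mat 1 + dyad (t + (t + t * t)) x x"
    if "(\<Sum>i\<in>UNIV. cnj (x $ i) * x $ i) = 1" for x :: "complex ^ 'a"
    by (simp only: matrix_add_ldistrib matrix_add_mult_distrib matrix_mul_lid matrix_mul_rid
        dyad_mult[OF that] add.assoc dyad_add)
  have left: "(mat 1 + dyad t x x) ** dyad d x y = dyad (d + t * d) x y"
    if "(\<Sum>i\<in>UNIV. cnj (x $ i) * x $ i) = 1" for d and x y :: "complex ^ 'a"
    by (simp add: matrix_add_mult_distrib dyad_mult[OF that] dyad_add)
  have right: "dyad d x y ** (mat 1 + dyad t y y) = dyad (d + d * t) x y"
    if "(\<Sum>i\<in>UNIV. cnj (y $ i) * y $ i) = 1" for d and x y :: "complex ^ 'a"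
    by (simp add: matrix_add_ldistrib dyad_mult[OF that] dyad_add)
  have "dagger ?W ** ?W = mat 1"
    unfolding W'
    unfolding W ancilla_matrix_mult sq[OF a] sq[OF b] left[OF a] left[OF b] right[OF a] right[OF b]
      dyad_mult[OF a] dyad_mult[OF b] dyad_add sum1
    by (simp add: t dyad_zero mult.commute ancilla_matrix_one)
  \<comment> \<open>A left inverse of a square matrix is also a right inverse.\<close>
  then show ?thesis
    unfolding unitary_mat_def using matrix_left_right_inverse by blast
qed

text \<open>\<open>annihilation q\<close> kills every one-particle basis state except the one in
  orbital \<open>q\<close>, which it returns to the vacuum.\<close>

lemma annihilation_comb_creation_comb_vacuum:
  "annihilation_comb v *v (creation_comb u *v vacuum) = (\<Sum>p\<in>UNIV. cnj (v $ p) * u $ p) *s vacuum"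
proof -
  have "annihilation q *v (creation_comb u *v vacuum) = u $ q *s vacuum" for q
  proof -
    have "annihilation q *v (creation_comb u *v vacuum)
        = (\<Sum>p\<in>UNIV. u $ p *s (annihilation q *v (creation p *v vacuum)))"
      unfolding creation_comb_def sum_mult_vec cscale_mult_vec
      by (simp add: vec.linear_sum[OF matrix_vector_mul_linear_gen] vector_scalar_commute)
    also have "\<dots> = (\<Sum>p\<in>UNIV. if p = q then u $ p *s vacuum else 0)"
      by (rule sum.cong) (auto simp: annihilation_creation_vacuum)
    finally show ?thesis by simp
  qed
  then show ?thesis
    unfolding annihilation_comb_def sum_mult_vec cscale_mult_vec
    by (simp add: vec.scale_sum_left vec.scale_scale)
qed

text \<open>The squared norm of \<open>|u>\<close> is the vacuum expectation of
  \<open>annihilation_comb u ** creation_comb u\<close>, that is, the matrix entry at the all-zero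
  bit string; the preceding lemma evaluates it.\<close>

lemma creation_comb_vacuum_unit:
  fixes u :: "complex ^ 'n::{finite,linorder}"
  assumes "(\<Sum>p\<in>UNIV. (cmod (u $ p))\<^sup>2) = 1"
  shows "(\<Sum>i\<in>UNIV. cnj ((creation_comb u *v vacuum) $ i) * (creation_comb u *v vacuum) $ i) = 1"
proof -
  have "complex_of_real (\<Sum>p\<in>UNIV. (cmod (u $ p))\<^sup>2) = 1"
    by (simp only: assms of_real_1)
  then have one: "(\<Sum>p\<in>UNIV. cnj (u $ p) * u $ p) = 1"
    by (simp only: of_real_sum complex_norm_square mult.commute)
  let ?C = "creation_comb u" and ?z = "(\<lambda>_. 0) :: 'n \<Rightarrow> 2"
  have adj: "dagger ?C = annihilation_comb u"
    by (simp flip: dagger_annihilation_comb)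
  have "(\<Sum>i\<in>UNIV. cnj ((?C *v vacuum) $ i) * (?C *v vacuum) $ i) = (dagger ?C ** ?C) $ ?z $ ?z"
    by (simp add: vacuum_def matrix_mult_axis matrix_matrix_mult_def)
  also have "\<dots> = (annihilation_comb u *v (?C *v vacuum)) $ ?z"
    unfolding adj vacuum_def matrix_mult_axis
    by (simp add: matrix_matrix_mult_def matrix_vector_mult_def)
  also have "\<dots> = 1"
    unfolding annihilation_comb_creation_comb_vacuum one
    by (simp add: vacuum_def axis_def)
  finally show ?thesis .
qed

theorem lemma1:
  fixes u v :: "complex ^ 'n::{finite,linorder}"
    and l :: complex
    and \<epsilon> \<alpha> :: real
  assumes "(\<Sum>p\<in>UNIV. (cmod (u $ p))\<^sup>2) = 1"
    and "(\<Sum>p\<in>UNIV. (cmod (v $ p))\<^sup>2) = 1"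
    and "\<epsilon> > 0"
    and "\<alpha> > 0"
    and "\<alpha> \<ge> cmod l"
  shows "\<exists>W :: complex ^ (2 \<times> ('n \<Rightarrow> 2)) ^ (2 \<times> ('n \<Rightarrow> 2)).
    unitary_mat W \<and>
    op_norm (one_particle_projector
        ** (ancilla_block W - cscale (1 / complex_of_real \<alpha>) (bilinear_rank_one l u v))
        ** one_particle_projector) < \<epsilon>"
proof -
  define a where "a = creation_comb u *v vacuum"
  define b where "b = creation_comb v *v vacuum"
  define c where "c = l / complex_of_real \<alpha>"
  define s where "s = sqrt (1 - (cmod c)\<^sup>2)"
  \<comment> \<open>This is where \<alpha> \<ge> |l| enters: the radicand in \<open>s\<close> is
    nonnegative, so \<open>s\<close> squares to it.\<close>
  have "cmod c \<le> 1"
    using assms(4,5) by (simp add: c_def norm_divide)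
  then have s: "(cmod c)\<^sup>2 + s\<^sup>2 = 1"
    by (simp add: s_def power_le_one)
  let ?P = "one_particle_projector :: complex ^ ('n \<Rightarrow> 2) ^ ('n \<Rightarrow> 2)"
  let ?L = "cscale (1 / complex_of_real \<alpha>) (bilinear_rank_one l u v)"
  let ?W = "ancilla_matrix (dyad c a b) (mat 1 + dyad (complex_of_real s - 1) a a)
    (mat 1 + dyad (complex_of_real s - 1) b b) (- dagger (dyad c a b))"
  have unitary: "unitary_mat ?W"
    using creation_comb_vacuum_unit[OF assms(1)] creation_comb_vacuum_unit[OF assms(2)] s
    unfolding a_def b_def by (rule unitary_ancilla_matrix_dyad)
  \<comment> \<open>The two operators are compared on the sector only; on other particle numbers
    they differ in general.\<close>
  have agree: "dyad c a b *v x = ?L *v x" if "x \<in> one_particle_sector" for x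
    using bilinear_dyad[OF that, of u v]
    by (simp add: bilinear_rank_one_def cscale_mult_vec dyad_mult_vec a_def b_def c_def vec.scale_scale)
  have proj: "orthogonal_projector one_particle_sector ?P"
    by (rule one_particle_projector)
  have "?P *v x \<in> one_particle_sector" for x
    using proj by (auto simp: orthogonal_projector_def)
  \<comment> \<open>The right-hand projector feeds the difference a vector of the sector, where it
    vanishes.\<close>
  then have "(?P ** (dyad c a b - ?L) ** ?P) *v x = 0" for x
    by (simp add: matrix_vector_mult_diff_rdistrib agree flip: matrix_vector_mul_assoc)
  then have "(*v) (?P ** (dyad c a b - ?L) ** ?P) = (\<lambda>x. 0)"
    by (rule ext)
  then have "op_norm (?P ** (dyad c a b - ?L) ** ?P) = 0"
    by (simp only: op_norm_def onorm_zero)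
  then show ?thesis
    using unitary assms(3) by (intro exI[of _ ?W]) (simp add: ancilla_block_ancilla_matrix)
qed

end
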